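(* Let $q$ be a prime power, let $C$ be an $[n,k]$ code over $\mathbb{F}_{q^2}$ with generator matrix $G = \begin{pmatrix} I_k & A \end{pmatrix}$, where $A$ is a $k \times (n-k)$ matrix, and let $x,y \in \mathbb{F}_{q^2}^{n-k}$ be nonzero vectors. Suppose that $(x,x)_h=(y,y)_h=(x,y)_h=0$. Then $\dim(\mathrm{Hull}_h(C(A(x,y)))) = \dim(\mathrm{Hull}_h(C))$.
   Context: An $[n,k]$ code over $\mathbb{F}_{q^2}$ is a $k$-dimensional subspace of $\mathbb{F}_{q^2}^n$; a generator matrix of it is a matrix whose rows form a basis of it. $I_k$ is the identity matrix of order $k$. For $a\in\mathbb{F}_{q^2}$, $\overline{a}=a^q$. The Hermitian inner product of $u,v\in\mathbb{F}_{q^2}^m$ is $(u,v)_h=\sum_{i=1}^m u_i\overline{v_i}$. The Hermitian dual code of a code $C$ of length $n$ is $C^{\perp h}=\{u\in\mathbb{F}_{q^2}^n \mid (u,v)_h=0 \text{ for all } v\in C\}$, and the Hermitian hull is $\mathrm{Hull}_h(C)=C\cap C^{\perp h}$. For a $k\times(n-k)$ matrix $A$ over $\mathbb{F}_{q^2}$ with rows $r_1,\dots,r_k$ and $x,y\in\mathbb{F}_{q^2}^{n-k}$, $A(x,y)$ denotes the $k\times(n-k)$ matrix whose $i$-th row is $r_i'=r_i+(r_i,y)_h\,x-(r_i,x)_h\,y$. $C(A(x,y))$ denotes the code with generator matrix $\begin{pmatrix} I_k & A(x,y)\end{pmatrix}$. *)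

theory Defs
  imports
    "Jordan_Normal_Form.VS_Connect"
    "HOL-Number_Theory.Prime_Powers"
begin

text \<open>Codes are subspaces of the space \<^term>\<open>module_vec TYPE('a::field) n\<close> of vectors of dimension
  \<^term>\<open>n\<close>, over a finite field \<^typ>\<open>'a\<close>. As the order of that field is only fixed by
  a hypothesis (the cardinality is the square of \<^term>\<open>q\<close>), the notions that involve the
  conjugation map \<^term>\<open>\<lambda>a. a ^ q\<close> carry \<^term>\<open>q\<close> as a parameter.\<close>

abbreviation code_space :: "nat \<Rightarrow> 'a::field vec set \<Rightarrow> ('a, 'a vec) module" where
  "code_space n C \<equiv> (module_vec TYPE('a) n)\<lparr>carrier := C\<rparr>"

definition code_dim :: "nat \<Rightarrow> 'a::field vec set \<Rightarrow> nat" where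
  "code_dim n C = vectorspace.dim class_ring (code_space n C)"

definition linear_code :: "nat \<Rightarrow> nat \<Rightarrow> 'a::field vec set \<Rightarrow> bool" where
  "linear_code n k C \<longleftrightarrow>
     VectorSpace.subspace class_ring C (module_vec TYPE('a) n) \<and> code_dim n C = k"

text \<open>The rows are required to be distinct because \<^const>\<open>vectorspace.basis\<close> speaks about the set
  of rows only, which would allow repetitions.\<close>

definition generator_matrix :: "nat \<Rightarrow> nat \<Rightarrow> 'a::field mat \<Rightarrow> 'a vec set \<Rightarrow> bool" where
  "generator_matrix n k G C \<longleftrightarrow>
     G \<in> carrier_mat k n \<and> distinct (rows G) \<and>
     vectorspace.basis class_ring (code_space n C) (set (rows G))"

text \<open>The block matrix with the identity on the left and \<^term>\<open>A\<close> on the right; the two lower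
  blocks have no rows.\<close>

definition std_gen :: "'a::field mat \<Rightarrow> 'a mat" where
  "std_gen A = four_block_mat (1\<^sub>m (dim_row A)) A (0\<^sub>m 0 (dim_row A)) (0\<^sub>m 0 (dim_col A))"

definition code_of :: "'a::field mat \<Rightarrow> 'a vec set" where
  "code_of A = vec_space.row_space (dim_row A + dim_col A) (std_gen A)"

definition herm :: "nat \<Rightarrow> 'a::field vec \<Rightarrow> 'a vec \<Rightarrow> 'a" where
  "herm q u v = u \<bullet> map_vec (\<lambda>a. a ^ q) v"

definition herm_dual :: "nat \<Rightarrow> nat \<Rightarrow> 'a::field vec set \<Rightarrow> 'a vec set" where
  "herm_dual q n C = {u \<in> carrier_vec n. \<forall>v\<in>C. herm q u v = 0}"

definition herm_hull :: "nat \<Rightarrow> nat \<Rightarrow> 'a::field vec set \<Rightarrow> 'a vec set" where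
  "herm_hull q n C = C \<inter> herm_dual q n C"

definition row_transform :: "nat \<Rightarrow> 'a::field mat \<Rightarrow> 'a vec \<Rightarrow> 'a vec \<Rightarrow> 'a mat" where
  "row_transform q A x y =
     mat_of_rows (dim_col A)
       (map (\<lambda>r. r + herm q r y \<cdot>\<^sub>v x - herm q r x \<cdot>\<^sub>v y) (rows A))"

lemma std_gen_carrier: "std_gen A \<in> carrier_mat (dim_row A) (dim_row A + dim_col A)"
  unfolding std_gen_def by (rule carrier_matI) auto

lemma row_std_gen_left:
  assumes "i < dim_row A" "j < dim_row A"
  shows "row (std_gen A) i $ j = (if i = j then 1 else 0)"
  using assms by (simp add: std_gen_def)

lemma row_transform_carrier [simp]:
  "row_transform q A x y \<in> carrier_mat (dim_row A) (dim_col A)"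
  unfolding row_transform_def by (rule carrier_matI) auto

text \<open>\<^term>\<open>code_of A\<close> is indeed the code with generator matrix \<^term>\<open>std_gen A\<close>.\<close>

lemma generator_matrix_code_of:
  fixes A :: "'a::field mat"
  assumes A: "A \<in> carrier_mat k m"
  shows "generator_matrix (k + m) k (std_gen A) (code_of A)"
proof -
  define n where "n = k + m"
  interpret vec_space "TYPE('a)" n .
  define G where "G = std_gen A"
  define S where "S = set (rows G)"
  have dim: "dim_row A = k" "dim_col A = m" using A by auto
  have G: "G \<in> carrier_mat k n"
    using std_gen_carrier[of A] unfolding G_def n_def dim .
  have S: "S \<subseteq> carrier_vec n" unfolding S_def using G by (metis rows_carrier carrier_matD(2))
  have entry: "row G i $ j = (if i = j then 1 else 0)" if "i < k" "j < k" for i j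
    using row_std_gen_left[of i A j] that unfolding G_def dim by simp
  have row_inj: "i = j" if "i < k" "j < k" "row G i = row G j" for i j
    using entry[of i j] entry[of j j] that by (metis zero_neq_one)
  have dist: "distinct (rows G)"
    using G row_inj by (auto simp: rows_def distinct_map inj_on_def)
  have SI: "S = row G ` {..<k}" unfolding S_def rows_def using G by auto
  have indpt: "lin_indpt S"
  proof (rule finite_lin_indpt2)
    show "finite S" unfolding S_def by simp
    show "S \<subseteq> carrier_vec n" by (rule S)
    fix a assume z: "lincomb a S = 0\<^sub>v n"
    show "\<forall>v\<in>S. a v = 0"
    proof
      fix v assume "v \<in> S"
      then obtain i where i: "i < k" "v = row G i" unfolding SI by auto
      have inj: "inj_on (row G) {..<k}" using row_inj by (auto simp: inj_on_def)
      have "0 = lincomb a S $ i" unfolding z using i n_def by simp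
      also have "\<dots> = (\<Sum>w\<in>S. a w * w $ i)"
        using lincomb_index[of i S a] S i n_def by simp
      also have "\<dots> = (\<Sum>j<k. a (row G j) * row G j $ i)"
        unfolding SI by (simp add: sum.reindex[OF inj])
      also have "\<dots> = (\<Sum>j<k. if j = i then a (row G j) else 0)"
        by (rule sum.cong) (use entry i in auto)
      also have "\<dots> = a v" using i by simp
      finally show "a v = 0" by simp
    qed
  qed
  have sub: "submodule class_ring (span S) V" using span_is_submodule S by simp
  have vs: "vectorspace class_ring (vs (span S))"
    using span_is_subspace[of S] S subspace_is_vs by simp
  have "S \<subseteq> span S" using in_own_span S by simp
  then have "vectorspace.basis class_ring (vs (span S)) S"
    unfolding vectorspace.basis_def[OF vs]
    using span_li_not_depend[OF _ sub, of S] indpt by simp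
  then show ?thesis
    using G dist
    unfolding generator_matrix_def code_of_def dim S_def G_def n_def[symmetric] row_space_def
    by simp
qed

end

theory Submission
  imports Defs "HOL-Number_Theory.Residues"
begin

text \<open>Put \<open>\<Phi> v = v + (v,y)x - (v,x)y\<close> on the whole ambient space, after padding \<open>x\<close> and \<open>y\<close> with
  \<open>k\<close> leading zeros. This linear map takes the \<open>i\<close>-th row of \<open>(I A)\<close> to the \<open>i\<close>-th row of
  \<open>(I A(x,y))\<close>, so \<open>C(A(x,y)) = \<Phi>(C)\<close>. As \<open>x\<close> and \<open>y\<close> span a totally isotropic subspace,
  \<open>\<Phi>\<close> is injective and preserves the Hermitian form; hence it maps the hull of \<open>C\<close>
  isomorphically onto the hull of \<open>\<Phi>(C)\<close>.\<close>

section \<open>The Hermitian form and the shear map\<close>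

text \<open>The length is left open, so that the same map acts on the rows of \<open>A\<close> and,
  with padded \<open>x\<close> and \<open>y\<close>, on whole codewords.\<close>

definition herm_shear :: "nat \<Rightarrow> 'a::field vec \<Rightarrow> 'a vec \<Rightarrow> 'a vec \<Rightarrow> 'a vec" where
  "herm_shear q x y v = v + herm q v y \<cdot>\<^sub>v x - herm q v x \<cdot>\<^sub>v y"

lemma herm_shear_carrier [simp]:
  assumes "x \<in> carrier_vec n" "y \<in> carrier_vec n" "v \<in> carrier_vec n"
  shows "herm_shear q x y v \<in> carrier_vec n"
  using assms by (simp add: herm_shear_def)

lemma herm_add_left:
  assumes "u \<in> carrier_vec n" "v \<in> carrier_vec n" "w \<in> carrier_vec n"
  shows "herm q (u + v) w = herm q u w + herm q v w"
  unfolding herm_def by (rule add_scalar_prod_distrib) (use assms in auto)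

lemma herm_smult_left:
  assumes "u \<in> carrier_vec n" "w \<in> carrier_vec n"
  shows "herm q (c \<cdot>\<^sub>v u) w = c * herm q u w"
  unfolding herm_def using assms by simp

lemma herm_minus_left:
  assumes "u \<in> carrier_vec n" "v \<in> carrier_vec n" "w \<in> carrier_vec n"
  shows "herm q (u - v) w = herm q u w - herm q v w"
  unfolding herm_def by (rule minus_scalar_prod_distrib) (use assms in auto)

lemma herm_append:
  assumes "u \<in> carrier_vec k" "u' \<in> carrier_vec k" "v \<in> carrier_vec m" "v' \<in> carrier_vec m"
  shows "herm q (u @\<^sub>v v) (u' @\<^sub>v v') = herm q u u' + herm q v v'"
proof -
  have "map_vec (\<lambda>a. a ^ q) (u' @\<^sub>v v') = map_vec (\<lambda>a. a ^ q) u' @\<^sub>v map_vec (\<lambda>a. a ^ q) v'"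
    by (rule eq_vecI) (auto simp: index_append_vec)
  then show ?thesis
    unfolding herm_def by (simp, subst scalar_prod_append[of _ k _ m]) (use assms in auto)
qed

text \<open>Positivity of \<open>q\<close> matters here: since \<open>0 ^ 0 = 1\<close>, conjugation
  with exponent 0 would not fix the zero vector.\<close>

lemma herm_zero_right:
  assumes "q > 0" "u \<in> carrier_vec n"
  shows "herm q u (0\<^sub>v n) = 0"
  using assms by (simp add: herm_def scalar_prod_def zero_power)

text \<open>The leading zeros make both products ignore \<open>u\<close>, and the correction terms
  vanish on the first \<open>k\<close> coordinates. The identity block of a generator matrix
  therefore survives the shear.\<close>

lemma herm_shear_append:
  assumes q: "q > 0" and u: "u \<in> carrier_vec k"
    and x: "x \<in> carrier_vec m" and y: "y \<in> carrier_vec m" and v: "v \<in> carrier_vec m"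
  shows "herm_shear q (0\<^sub>v k @\<^sub>v x) (0\<^sub>v k @\<^sub>v y) (u @\<^sub>v v) = u @\<^sub>v herm_shear q x y v"
proof -
  have "herm q (u @\<^sub>v v) (0\<^sub>v k @\<^sub>v z) = herm q v z" if "z \<in> carrier_vec m" for z
    using that herm_append[OF u zero_carrier_vec v that] herm_zero_right[OF q u] by simp
  then show ?thesis
    unfolding herm_shear_def using assms by (intro eq_vecI) (auto simp: index_append_vec)
qed

lemma herm_shear_add:
  assumes "x \<in> carrier_vec n" "y \<in> carrier_vec n" "u \<in> carrier_vec n" "v \<in> carrier_vec n"
  shows "herm_shear q x y (u + v) = herm_shear q x y u + herm_shear q x y v"
  unfolding herm_shear_def using assms
  by (intro eq_vecI) (auto simp: herm_add_left[of _ n] algebra_simps)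

lemma herm_shear_smult:
  assumes "x \<in> carrier_vec n" "y \<in> carrier_vec n" "v \<in> carrier_vec n"
  shows "herm_shear q x y (c \<cdot>\<^sub>v v) = c \<cdot>\<^sub>v herm_shear q x y v"
  unfolding herm_shear_def using assms
  by (intro eq_vecI) (auto simp: herm_smult_left[of _ n] algebra_simps)

section \<open>Rows of standard generator matrices\<close>

lemma row_std_gen:
  assumes A: "A \<in> carrier_mat k m" and i: "i < k"
  shows "row (std_gen A) i = unit_vec k i @\<^sub>v row A i"
  using assms unfolding std_gen_def
  by (intro eq_vecI) (auto simp: index_append_vec)

lemma set_rows_std_gen:
  assumes "A \<in> carrier_mat k m"
  shows "set (rows (std_gen A)) = (\<lambda>i. unit_vec k i @\<^sub>v row A i) ` {..<k}"
  using row_std_gen[OF assms] std_gen_carrier[of A] assms by (auto simp: rows_def)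

lemma row_row_transform:
  assumes "A \<in> carrier_mat k m" "i < k" "x \<in> carrier_vec m" "y \<in> carrier_vec m"
  shows "row (row_transform q A x y) i = herm_shear q x y (row A i)"
  unfolding row_transform_def herm_shear_def
  by (subst mat_of_rows_row) (use assms in auto)

text \<open>Taking spans on both sides later shows that the transformed code is the image of the
  original one.\<close>

lemma set_rows_row_transform:
  assumes q: "q > 0" and A: "A \<in> carrier_mat k m"
    and x: "x \<in> carrier_vec m" and y: "y \<in> carrier_vec m"
  shows "set (rows (std_gen (row_transform q A x y))) =
    herm_shear q (0\<^sub>v k @\<^sub>v x) (0\<^sub>v k @\<^sub>v y) ` set (rows (std_gen A))"
proof -
  have "row_transform q A x y \<in> carrier_mat k m"
    using A row_transform_carrier[of q A x y] by simp
  then show ?thesis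
    unfolding set_rows_std_gen[OF A] image_image
    using herm_shear_append[OF q _ x y] row_row_transform[OF A _ x y] A
    by (subst set_rows_std_gen) (auto intro!: image_cong)
qed

section \<open>Conjugation in a field of order \<open>q ^ 2\<close>\<close>

lemma power_card_eq_self:
  fixes a :: "'a::{field,finite}"
  shows "a ^ card (UNIV :: 'a set) = a"
proof (cases "a = 0")
  case False
  let ?P = "\<Prod>b\<in>UNIV - {0::'a}. b"
  \<comment> \<open>Multiplication by \<open>a\<close> permutes the nonzero elements, so it leaves
    their product unchanged.\<close>
  have "(\<Prod>b\<in>UNIV - {0}. a * b) = ?P"
    by (rule prod.reindex_bij_witness[of _ "\<lambda>b. b / a" "\<lambda>b. a * b"]) (use False in auto)
  then have "a ^ (card (UNIV :: 'a set) - 1) * ?P = ?P"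
    by (simp add: prod.distrib card_Diff_subset)
  moreover have "?P \<noteq> 0" by simp
  ultimately have "a ^ (card (UNIV :: 'a set) - 1) = 1" by simp
  then have "a ^ Suc (card (UNIV :: 'a set) - 1) = a" by simp
  then show ?thesis by (simp add: finite_UNIV_card_ge_0)
qed (simp add: finite_UNIV_card_ge_0 zero_power)

text \<open>The prime power hypothesis makes \<open>a ^ q\<close> additive in \<open>a\<close>, and
  the cardinality makes it an involution. The parameter \<open>field_type\<close> ties
  \<open>q\<close> to the field.\<close>

locale square_order_field =
  fixes q :: nat and field_type :: "'a::{field,finite} itself"
  assumes primepow_q: "primepow q" and card_field: "card (UNIV :: 'a set) = q ^ 2"
begin

lemma q_pos: "q > 0"
  using primepow_q primepow_gt_0_nat by auto

lemma conj_add: "(a + b :: 'a) ^ q = a ^ q + b ^ q"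
proof -
  have prime: "prime CHAR('a)"
    by (rule prime_CHAR_semidom) (simp add: finite_imp_CHAR_pos)
  obtain p e where p: "prime p" "q = p ^ e"
    using primepow_q unfolding primepow_def by auto
  \<comment> \<open>The characteristic divides the order of the field, a power of \<open>p\<close>.
    Hence the two primes agree, and conjugation is an iterate of the Frobenius map.\<close>
  have "CHAR('a) dvd p"
    using CHAR_dvd_CARD[where 'a = 'a] prime prime_dvd_power unfolding card_field p by blast
  then have "q = CHAR('a) ^ e"
    using p prime primes_dvd_imp_eq by blast
  then show ?thesis
    by (rule freshmans_dream'[OF prime])
qed

lemma conj_conj: "((a :: 'a) ^ q) ^ q = a"
  using power_card_eq_self[of a] unfolding card_field by (simp add: power_mult power2_eq_square)

lemma conj_sum: "(\<Sum>i\<in>I. f i :: 'a) ^ q = (\<Sum>i\<in>I. f i ^ q)"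
  by (induction I rule: infinite_finite_induct) (auto simp: conj_add zero_power q_pos)

lemma conj_diff: "(a - b :: 'a) ^ q = a ^ q - b ^ q"
  using conj_add[of "a - b" b] by (simp add: eq_diff_eq)

text \<open>Conjugating termwise turns each \<open>v $ i * (u $ i) ^ q\<close> into
  \<open>(v $ i) ^ q * u $ i\<close>, because conjugation is an involution.\<close>

lemma herm_conj:
  fixes u v :: "'a vec"
  assumes "u \<in> carrier_vec n" "v \<in> carrier_vec n"
  shows "herm q u v = herm q v u ^ q"
  using assms unfolding herm_def scalar_prod_def
  by (auto simp: conj_sum power_mult_distrib conj_conj mult.commute intro!: sum.cong)

text \<open>Follows from linearity in the first argument by Hermitian symmetry. The coefficients
  \<open>herm q y v\<close> and \<open>herm q x v\<close> are the conjugates of those in the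
  shear.\<close>

lemma herm_shear_right:
  fixes u v x y :: "'a vec"
  assumes c: "x \<in> carrier_vec n" "y \<in> carrier_vec n" "u \<in> carrier_vec n" "v \<in> carrier_vec n"
  shows "herm q u (herm_shear q x y v) = herm q u v + herm q y v * herm q u x - herm q x v * herm q u y"
proof -
  have "herm q u (herm_shear q x y v) = herm q (herm_shear q x y v) u ^ q"
    using c by (intro herm_conj[of _ n]) auto
  also have "herm q (herm_shear q x y v) u =
      herm q v u + herm q v y * herm q x u - herm q v x * herm q y u"
    unfolding herm_shear_def using c
    by (simp add: herm_add_left[of _ n] herm_minus_left[of _ n] herm_smult_left[of _ n])
  finally show ?thesis
    using c by (simp add: conj_add conj_diff power_mult_distrib
      herm_conj[of u n v] herm_conj[of u n x] herm_conj[of u n y]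
      herm_conj[of x n v] herm_conj[of y n v])
qed

end

section \<open>The shear along a totally isotropic pair is an injective isometry\<close>

locale isotropic_pair = square_order_field q field_type
  for q :: nat and field_type :: "'a::{field,finite} itself" +
  fixes n :: nat and x y :: "'a vec"
  assumes x: "x \<in> carrier_vec n" and y: "y \<in> carrier_vec n"
    and xx: "herm q x x = 0" and yy: "herm q y y = 0" and xy: "herm q x y = 0"
begin

lemma yx: "herm q y x = 0"
  using herm_conj[OF y x] xy q_pos by (simp add: zero_power)

abbreviation T :: "'a vec \<Rightarrow> 'a vec" where
  "T \<equiv> herm_shear q x y"

lemma herm_T_left:
  assumes "u \<in> carrier_vec n" "w \<in> carrier_vec n"
  shows "herm q (T u) w = herm q u w + herm q u y * herm q x w - herm q u x * herm q y w"
  unfolding herm_shear_def using assms x y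
  by (simp add: herm_add_left[of _ n] herm_minus_left[of _ n] herm_smult_left[of _ n])

text \<open>By Hermitian symmetry, \<open>(u,y)(x,v)\<close> and \<open>(u,x)(y,v)\<close> each arise from both arguments, with
  opposite signs.\<close>

lemma herm_T_T:
  assumes "u \<in> carrier_vec n" "v \<in> carrier_vec n"
  shows "herm q (T u) (T v) = herm q u v"
  using assms x y
  by (simp add: herm_T_left herm_shear_right[of _ n] xx yy xy yx algebra_simps)

lemma inj_on_T: "inj_on T (carrier_vec n)"
proof (rule inj_onI)
  fix u v assume u: "u \<in> carrier_vec n" and v: "v \<in> carrier_vec n" and eq: "T u = T v"
  \<comment> \<open>The correction terms are orthogonal to \<open>x\<close> and \<open>y\<close>, so
    \<open>T\<close> preserves products with both. Equal images thus have equal correction terms,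
    which cancel below.\<close>
  have "herm q u x = herm q v x" "herm q u y = herm q v y"
    using arg_cong[OF eq, of "\<lambda>w. herm q w x"] arg_cong[OF eq, of "\<lambda>w. herm q w y"] u v x y
    by (simp_all add: herm_T_left xx yy xy yx)
  show "u = v"
  proof (rule eq_vecI)
    fix i assume "i < dim_vec v"
    then show "u $ i = v $ i"
      using arg_cong[OF eq, of "\<lambda>w. w $ i"] u v x y \<open>herm q u x = herm q v x\<close> \<open>herm q u y = herm q v y\<close>
      by (simp add: herm_shear_def)
  qed (use u v in simp)
qed

text \<open>Only dual vectors inside the code enter the hull, so it suffices that \<open>T\<close>
  preserves products between codewords; the whole dual need not be transported.\<close>

lemma herm_hull_image:
  assumes "C \<subseteq> carrier_vec n"
  shows "herm_hull q n (T ` C) = T ` herm_hull q n C"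
  using assms x y herm_T_T unfolding herm_hull_def herm_dual_def by (auto simp: subset_eq)

sublocale vec_space field_type n .

lemma linear_map_T: "linear_map class_ring V V T"
proof -
  have "T \<in> LinearCombinations.module_hom class_ring V V"
    using x y by (auto simp: LinearCombinations.module_hom_def
      herm_shear_add[of _ n] herm_shear_smult[of _ n])
  then show ?thesis
    unfolding linear_map_def mod_hom_def mod_hom_axioms_def
    using vectorspace_axioms module_axioms by blast
qed

end

section \<open>Hulls, spans and dimensions under linear maps\<close>

context vec_space
begin

text \<open>Membership in the dual constrains the first argument of the form, in which the form is
  linear.\<close>

lemma submodule_herm_hull:
  assumes "submodule class_ring C V" and q: "q > 0"
  shows "submodule class_ring (herm_hull q n C) V"
proof -
  have C: "C \<subseteq> carrier_vec n" using submodule.subset[OF assms(1)] by simp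
  have "0\<^sub>v n \<in> C" using submodule.zero_closed[OF assms(1)] by simp
  moreover have "u + v \<in> C" if "u \<in> C" "v \<in> C" for u v
    using submodule.m_closed[OF assms(1) that] by simp
  moreover have "c \<cdot>\<^sub>v v \<in> C" if "v \<in> C" for c v
    using submodule.smult_closed[OF assms(1) _ that, of c] by simp
  moreover have "herm q (0\<^sub>v n) v = 0" if "v \<in> C" for v
    using that C by (auto simp: herm_def)
  ultimately show ?thesis
    using C unfolding herm_hull_def herm_dual_def
    by (intro submodule.intro)
      (auto simp: herm_add_left[of _ n] herm_smult_left[of _ n] subset_eq module_axioms)
qed

text \<open>Both inclusions use minimality of spans: the image of \<open>span S\<close> is a
  submodule containing the image of \<open>S\<close>, and the preimage of the span of that image is
  a submodule containing \<open>S\<close>.\<close>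

lemma span_linear_image:
  assumes T: "linear_map class_ring V V T" and S: "S \<subseteq> carrier_vec n"
  shows "span (T ` S) = T ` span S"
proof -
  have hom: "T \<in> LinearCombinations.module_hom class_ring V V"
    using T by (simp add: linear_map_def mod_hom_def mod_hom_axioms_def)
  have closed: "T v \<in> carrier_vec n" if "v \<in> carrier_vec n" for v
    using LinearCombinations.module_hom_closed[OF hom] that by auto
  have add: "T (u + v) = T u + T v" if "u \<in> carrier_vec n" "v \<in> carrier_vec n" for u v
    using LinearCombinations.module_hom_add[OF hom] that by simp
  have smult: "T (c \<cdot>\<^sub>v v) = c \<cdot>\<^sub>v T v" if "v \<in> carrier_vec n" for c v
    using LinearCombinations.module_hom_smult[OF hom, of c v] that by simp
  have "0 \<cdot>\<^sub>v v = 0\<^sub>v n" if "v \<in> carrier_vec n" for v :: "'a vec"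
    using that by auto
  then have zero: "T (0\<^sub>v n) = 0\<^sub>v n"
    using smult[of "0\<^sub>v n" 0] closed[of "0\<^sub>v n"] by (metis zero_carrier_vec)
  have TS: "T ` S \<subseteq> carrier_vec n"
    using S closed by auto
  have sub: "submodule class_ring (span S) V"
    using span_is_submodule S by simp
  have spanS: "span S \<subseteq> carrier_vec n"
    using submodule.subset[OF sub] by simp
  show ?thesis
  proof
    have "submodule class_ring (T ` span S) V"
    proof (rule submodule.intro)
      show "T ` span S \<subseteq> carrier V" using spanS closed by auto
      have "0\<^sub>v n \<in> span S" using submodule.zero_closed[OF sub] by simp
      from imageI[OF this, of T] show "\<zero>\<^bsub>V\<^esub> \<in> T ` span S" by (simp add: zero)
    next
      fix v' w' assume "v' \<in> T ` span S" "w' \<in> T ` span S"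
      then obtain v w where vw: "v \<in> span S" "w \<in> span S" "v' = T v" "w' = T w" by blast
      from vw spanS have "v' + w' = T (v + w)" by (simp add: add subsetD)
      moreover have "v + w \<in> span S" using submodule.m_closed[OF sub vw(1,2)] by simp
      ultimately show "v' \<oplus>\<^bsub>V\<^esub> w' \<in> T ` span S" by simp
    next
      fix c v' assume "v' \<in> T ` span S"
      then obtain v where v: "v \<in> span S" "v' = T v" by blast
      from v spanS have "c \<cdot>\<^sub>v v' = T (c \<cdot>\<^sub>v v)" by (simp add: smult subsetD)
      moreover have "c \<cdot>\<^sub>v v \<in> span S" using submodule.smult_closed[OF sub _ v(1)] by simp
      ultimately show "c \<odot>\<^bsub>V\<^esub> v' \<in> T ` span S" by simp
    qed (rule module_axioms)
    moreover have "T ` S \<subseteq> T ` span S"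
      using in_own_span[of S] S by (intro image_mono) simp
    ultimately show "span (T ` S) \<subseteq> T ` span S"
      by (rule span_is_subset[rotated])
  next
    have sub': "submodule class_ring (span (T ` S)) V"
      using span_is_submodule TS by simp
    have "submodule class_ring {v \<in> carrier_vec n. T v \<in> span (T ` S)} V"
    proof (rule submodule.intro)
      show "\<zero>\<^bsub>V\<^esub> \<in> {v \<in> carrier_vec n. T v \<in> span (T ` S)}"
        using submodule.zero_closed[OF sub'] zero by simp
    next
      fix v w
      assume "v \<in> {v \<in> carrier_vec n. T v \<in> span (T ` S)}" "w \<in> {v \<in> carrier_vec n. T v \<in> span (T ` S)}"
      then show "v \<oplus>\<^bsub>V\<^esub> w \<in> {v \<in> carrier_vec n. T v \<in> span (T ` S)}"
        using submodule.m_closed[OF sub', of "T v" "T w"] add[of v w] by simp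
    next
      fix c v assume "v \<in> {v \<in> carrier_vec n. T v \<in> span (T ` S)}"
      then show "c \<odot>\<^bsub>V\<^esub> v \<in> {v \<in> carrier_vec n. T v \<in> span (T ` S)}"
        using submodule.smult_closed[OF sub', of c "T v"] smult[of v c] by simp
    qed (simp_all add: module_axioms)
    moreover have "S \<subseteq> {v \<in> carrier_vec n. T v \<in> span (T ` S)}"
    proof
      fix v assume v: "v \<in> S"
      have "T ` S \<subseteq> span (T ` S)" using in_own_span[of "T ` S"] TS by simp
      then show "v \<in> {v \<in> carrier_vec n. T v \<in> span (T ` S)}"
        using imageI[OF v, of T] subsetD[OF S v] by (simp add: subsetD)
    qed
    ultimately have "span S \<subseteq> {v \<in> carrier_vec n. T v \<in> span (T ` S)}"
      by (rule span_is_subset[rotated])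
    then show "T ` span S \<subseteq> span (T ` S)" by blast
  qed
qed

text \<open>Replacing the span inside \<open>W\<close> by the ambient one lets dimensions of
  different subspaces be compared in one space.\<close>

lemma code_dim_eq_Least:
  assumes "submodule class_ring W V"
  shows "code_dim n W = (LEAST d. \<exists>B. finite B \<and> card B = d \<and> B \<subseteq> W \<and> span B = W)"
proof -
  have vs: "vectorspace class_ring (vs W)"
    using assms by (intro subspace_is_vs subspace.intro vectorspace_axioms)
  have "LinearCombinations.module.span class_ring (vs W) B = span B" if "B \<subseteq> W" for B
    by (rule span_li_not_depend(1)[OF that assms])
  then show ?thesis
    unfolding code_dim_def vectorspace.dim_def[OF vs]
    by (intro arg_cong[of _ _ Least] ext ex_cong) auto
qed

text \<open>By injectivity, the spanning sets of the image are exactly the images of those of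
  \<open>W\<close>, with the same sizes, so both minima range over the same numbers.\<close>

lemma code_dim_linear_image:
  assumes T: "linear_map class_ring V V T" and inj: "inj_on T (carrier_vec n)"
    and W: "submodule class_ring W V" and TW: "submodule class_ring (T ` W) V"
  shows "code_dim n (T ` W) = code_dim n W"
proof -
  have Wc: "W \<subseteq> carrier_vec n"
    using submodule.subset[OF W] by simp
  have span: "span (T ` B) = T ` W \<longleftrightarrow> span B = W" if "B \<subseteq> W" for B
  proof -
    have "B \<subseteq> carrier_vec n" using that Wc by blast
    moreover from this have "span B \<subseteq> carrier_vec n"
      using span_is_subset2 by simp
    ultimately show ?thesis
      using span_linear_image[OF T] inj_on_image_eq_iff[OF inj] Wc by simp
  qed
  have card: "card (T ` B) = card B" "finite (T ` B) = finite B" if "B \<subseteq> W" for B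
    using inj_on_subset[OF inj] that Wc by (auto intro!: card_image simp: finite_image_iff)
  have "(\<exists>B. finite B \<and> card B = d \<and> B \<subseteq> T ` W \<and> span B = T ` W) \<longleftrightarrow>
      (\<exists>B. finite B \<and> card B = d \<and> B \<subseteq> W \<and> span B = W)" for d
    using span card by (metis subset_image_iff)
  then show ?thesis
    unfolding code_dim_eq_Least[OF W] code_dim_eq_Least[OF TW] by simp
qed

end

section \<open>Equality of the hull dimensions\<close>

theorem theorem3p2:
  fixes C :: "'a::{field,finite} vec set" and A :: "'a mat" and x y :: "'a vec"
    and q n k :: nat
  assumes "primepow q" and "card (UNIV :: 'a set) = q ^ 2"
    and "linear_code n k C"
    and "A \<in> carrier_mat k (n - k)"
    and "generator_matrix n k (std_gen A) C"
    and "x \<in> carrier_vec (n - k)" and "y \<in> carrier_vec (n - k)"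
    and "x \<noteq> 0\<^sub>v (n - k)" and "y \<noteq> 0\<^sub>v (n - k)"
    and "herm q x x = 0" and "herm q y y = 0" and "herm q x y = 0"
  shows "code_dim n (herm_hull q n (code_of (row_transform q A x y))) =
         code_dim n (herm_hull q n C)"
proof -
  define m where "m = n - k"
  have A: "A \<in> carrier_mat k m" and xm: "x \<in> carrier_vec m" and ym: "y \<in> carrier_vec m"
    using assms unfolding m_def by auto
  \<comment> \<open>Subtraction on naturals truncates, so this is read off the number of columns of
    the generator matrix.\<close>
  have n: "n = k + m"
    using assms(5) std_gen_carrier[of A] A unfolding generator_matrix_def by auto
  let ?x = "0\<^sub>v k @\<^sub>v x" and ?y = "0\<^sub>v k @\<^sub>v y"
  interpret square_order_field q "TYPE('a)"
    by unfold_locales (fact assms)+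
  have herm0: "herm q (0\<^sub>v k @\<^sub>v u) (0\<^sub>v k @\<^sub>v v) = herm q u v"
    if "u \<in> carrier_vec m" "v \<in> carrier_vec m" for u v :: "'a vec"
    using that q_pos by (simp add: herm_append[of _ k _ _ m] herm_zero_right[of _ _ k])
  interpret isotropic_pair q "TYPE('a)" n ?x ?y
    by unfold_locales (use xm ym n assms(10-12) in \<open>auto simp: herm0\<close>)
  have sub: "submodule class_ring C V" and vsC: "vectorspace class_ring (vs C)"
    using assms(3) subspace_is_vs unfolding linear_code_def subspace_def by auto
  have rows: "set (rows (std_gen A)) \<subseteq> C" "LinearCombinations.module.span class_ring (vs C) (set (rows (std_gen A))) = C"
    using assms(5) unfolding generator_matrix_def vectorspace.basis_def[OF vsC] by auto
  \<comment> \<open>The basis property concerns the span inside \<open>C\<close> as a space of its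
    own; here it is moved to the ambient space.\<close>
  have C: "C = span (set (rows (std_gen A)))"
    using span_li_not_depend(1)[OF rows(1) sub] rows(2) by simp
  have Cc: "C \<subseteq> carrier_vec n"
    using submodule.subset[OF sub] by simp
  have "code_of (row_transform q A x y) = span (T ` set (rows (std_gen A)))"
    using row_transform_carrier[of q A x y] A set_rows_row_transform[OF q_pos A xm ym]
    unfolding code_of_def by (simp add: n[symmetric] row_space_def)
  moreover have img: "span (T ` set (rows (std_gen A))) = T ` C"
    using span_linear_image[OF linear_map_T, of "set (rows (std_gen A))"] rows(1) Cc C by auto
  ultimately have code: "code_of (row_transform q A x y) = T ` C" by simp
  have "T ` set (rows (std_gen A)) \<subseteq> carrier_vec n"
    using rows(1) Cc xm ym n by auto
  then have "submodule class_ring (T ` C) V"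
    using span_is_submodule unfolding img[symmetric] by simp
  \<comment> \<open>This set is also the image of the hull of \<open>C\<close>, which supplies the
    submodule premise for the image in the dimension comparison.\<close>
  then have "submodule class_ring (herm_hull q n (T ` C)) V"
    using submodule_herm_hull q_pos by blast
  then show ?thesis
    unfolding code herm_hull_image[OF Cc]
    using code_dim_linear_image[OF linear_map_T inj_on_T submodule_herm_hull[OF sub q_pos]] by blast
qed

end
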